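(* Let $n\ge 2$ be an integer, let $\mathcal{A}$ be a unital algebra over a commutative unital ring $\mathcal{R}$ with a nontrivial idempotent $e$, and put $f=1-e$. Suppose that $\mathcal{A}$ is $2$- and $(n-1)$-torsion free, and that for each $x\in\mathcal{A}$: $exe\cdot e\mathcal{A}f=\{0\}=f\mathcal{A}e\cdot exe$ implies $exe=0$, and $e\mathcal{A}f\cdot fxf=\{0\}=fxf\cdot f\mathcal{A}e$ implies $fxf=0$. Let $\varphi$ be a Lie $n$-derivation on $\mathcal{A}$. Then $\varphi$ is standard if and only if all of the following hold: (i) $f\varphi(e\mathcal{A}e)f\subseteq f\mathcal{Z}(\mathcal{A})f$ and $e\varphi(f\mathcal{A}f)e\subseteq e\mathcal{Z}(\mathcal{A})e$; (ii) $e\varphi(tm)e+f\varphi(mt)f\in\mathcal{Z}(\mathcal{A})$ for each $m\in e\mathcal{A}f$ and $t\in f\mathcal{A}e$; (iii) $f\varphi(e\mathcal{A}f)e=e\varphi(f\mathcal{A}e)f=\{0\}$.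
   Context: Linear means $\mathcal{R}$-linear; $\mathcal{Z}(\mathcal{A})$ is the centre. Nontrivial idempotent: $e^2=e$, $e\ne 0,1$. For a positive integer $k$, $\mathcal{A}$ is $k$-torsion free if $kx=0$ implies $x=0$ for each $x\in\mathcal{A}$. $[x,y]=xy-yx$. Define $p_1(x_1)=x_1$ and $p_n(x_1,\dots,x_n)=[p_{n-1}(x_1,\dots,x_{n-1}),x_n]$ for $n\ge2$; for $n\ge 2$, $p_n(x_1,\dots,x_n)$ is called an $(n-1)$-th commutator. A linear map $\varphi:\mathcal{A}\to\mathcal{A}$ is a Lie $n$-derivation if $\varphi(p_n(x_1,\dots,x_n))=\sum_{i=1}^n p_n(x_1,\dots,x_{i-1},\varphi(x_i),x_{i+1},\dots,x_n)$ for all $x_1,\dots,x_n\in\mathcal{A}$. A Lie $n$-derivation is standard if it equals $h+\tau$ with $h$ a derivation on $\mathcal{A}$ (linear, $h(xy)=h(x)y+xh(y)$) and $\tau$ a linear mapping from $\mathcal{A}$ into $\mathcal{Z}(\mathcal{A})$ vanishing on all $(n-1)$-th commutators of $\mathcal{A}$. *)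

theory Defs
  imports Complex_Main
begin

(* An associative unital algebra carried by a whole type 'a of class ring_1, over a commutative
   unital ring 'r; the action of the ring of scalars is an explicit parameter. *)
locale unital_algebra = module scale
  for scale :: "'r::comm_ring_1 \<Rightarrow> 'a::ring_1 \<Rightarrow> 'a" +
  assumes scale_mult_left: "scale r x * y = scale r (x * y)"
    and scale_mult_right: "x * scale r y = scale r (x * y)"

definition center :: "'a::ring_1 set"
  where "center = {z. \<forall>x. z * x = x * z}"

definition commutator :: "'a::ring_1 \<Rightarrow> 'a \<Rightarrow> 'a"
  where "commutator x y = x * y - y * x"

(* p_n(x_1, ..., x_n): the arguments are the values of x at the indices 1, ..., n.
   The value for n = 0 is a dummy. *)
fun lie_p :: "nat \<Rightarrow> (nat \<Rightarrow> 'a::ring_1) \<Rightarrow> 'a" where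
  "lie_p 0 x = 0"
| "lie_p (Suc 0) x = x 1"
| "lie_p (Suc (Suc n)) x = commutator (lie_p (Suc n) x) (x (Suc (Suc n)))"

definition lie_n_derivation ::
  "('r::comm_ring_1 \<Rightarrow> 'a::ring_1 \<Rightarrow> 'a) \<Rightarrow> nat \<Rightarrow> ('a \<Rightarrow> 'a) \<Rightarrow> bool"
  where "lie_n_derivation scale n \<phi> \<longleftrightarrow>
    module_hom scale scale \<phi> \<and>
    (\<forall>x. \<phi> (lie_p n x) = (\<Sum>i=1..n. lie_p n (x(i := \<phi> (x i)))))"

definition derivation ::
  "('r::comm_ring_1 \<Rightarrow> 'a::ring_1 \<Rightarrow> 'a) \<Rightarrow> ('a \<Rightarrow> 'a) \<Rightarrow> bool"
  where "derivation scale h \<longleftrightarrow>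
    module_hom scale scale h \<and> (\<forall>x y. h (x * y) = h x * y + x * h y)"

definition standard ::
  "('r::comm_ring_1 \<Rightarrow> 'a::ring_1 \<Rightarrow> 'a) \<Rightarrow> nat \<Rightarrow> ('a \<Rightarrow> 'a) \<Rightarrow> bool"
  where "standard scale n \<phi> \<longleftrightarrow>
    (\<exists>h \<tau>. derivation scale h \<and> module_hom scale scale \<tau> \<and> range \<tau> \<subseteq> center \<and>
      (\<forall>x. \<tau> (lie_p n x) = 0) \<and> (\<forall>x. \<phi> x = h x + \<tau> x))"

(* The Peirce component u A v. *)
definition peirce :: "'a::ring_1 \<Rightarrow> 'a \<Rightarrow> 'a set"
  where "peirce u v = {u * x * v | x. True}"

end

theory Submission
  imports Defs
begin

text \<open>
  Write \<open>M = e A f\<close>, \<open>N = f A e\<close> and work with the Peirce decomposition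
  \<open>A = e A e + M + N + f A f\<close>. Bracketing with \<open>f\<close> kills the two diagonal components,
  is the identity on \<open>M\<close> and minus the identity on \<open>N\<close>. Hence long commutators in which
  nearly all arguments are \<open>f\<close> are short brackets up to sign, and they turn the identity
  of a Lie \<open>n\<close>-derivation into statements about two arguments.

  If \<open>\<phi> = h + \<tau>\<close> is standard, then the three conditions are read off: a derivation has
  zero component in \<open>f A f\<close> on \<open>e A e\<close> and in \<open>f A e\<close> on \<open>e A f\<close>, so only \<open>\<tau>\<close>
  contributes there, and \<open>\<tau>\<close> takes the same value at \<open>m t\<close> and \<open>t m\<close>, because
  \<open>[m, t]\<close> is the long commutator \<open>p\<^sub>n(m, f, \<dots>, f, t)\<close>.

  For the converse, subtract an inner derivation, which changes neither the conditions nor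
  the conclusion, so that \<open>\<phi> f\<close> commutes with \<open>f\<close>. Evaluating \<open>\<phi>\<close> at
  \<open>p\<^sub>n(m, f, \<dots>, f) = m\<close> gives \<open>\<phi> m\<close> again plus \<open>n - 1\<close> copies of
  \<open>[m, \<phi> f]\<close>; as \<open>A\<close> has no \<open>(n - 1)\<close>-torsion, \<open>\<phi> f\<close> commutes with \<open>M\<close>, likewise
  with \<open>N\<close>, and by faithfulness it is central (\<open>phi_f_center\<close>). Then all arguments
  \<open>f\<close> may be ignored (\<open>phi_two_slots\<close>), and with condition (iii) \<open>\<phi>\<close> preserves
  \<open>M\<close>, \<open>N\<close> and the diagonal. By (i), for \<open>a\<close> in \<open>e A e\<close> the component of \<open>\<phi> a\<close>
  in \<open>f A f\<close> is that of a central element \<open>\<tau> a\<close>. A central element is determined by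
  either of its diagonal components (\<open>center_eqI_e\<close>, \<open>center_eqI_f\<close>), so \<open>\<tau>\<close> is
  well defined and linear, and \<open>h = \<phi> - \<tau>\<close> preserves each Peirce component.

  The Leibniz rule for \<open>h\<close> is verified on pairs of components. Products of a diagonal and an
  off-diagonal element are brackets. For two elements of \<open>e A e\<close> the defect of the
  Leibniz rule annihilates \<open>M\<close> from the left and \<open>N\<close> from the right, hence vanishes. For
  \<open>m\<close> in \<open>M\<close> and \<open>t\<close> in \<open>N\<close>, condition (ii) is precisely
  \<open>\<tau> (m t) = \<tau> (t m)\<close>, so that \<open>h\<close> obeys the rule on \<open>[m, t]\<close>, whose two summands lie
  in different components. Finally \<open>h\<close> and \<open>\<phi>\<close> satisfy the same identity on long
  commutators up to brackets with central elements, so \<open>\<tau>\<close> vanishes on them.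
\<close>

section \<open>Iterated commutators\<close>

lemma commutator_add_left: "commutator (x + y) z = commutator x z + commutator y z"
  and commutator_diff_left: "commutator (x - y) z = commutator x z - commutator y z"
  and commutator_diff_right: "commutator x (y - z) = commutator x y - commutator x z"
  and commutator_zero_left [simp]: "commutator 0 z = 0"
  and commutator_zero_right [simp]: "commutator z 0 = 0"
  by (simp_all add: commutator_def algebra_simps)

lemma commutator_sum_left: "commutator (sum g A) z = (\<Sum>i\<in>A. commutator (g i) z)"
  by (simp add: commutator_def sum_distrib_left sum_distrib_right sum_subtractf)

lemma commutator_center: "z \<in> center \<Longrightarrow> commutator x z = 0" "z \<in> center \<Longrightarrow> commutator z x = 0"
  by (simp_all add: commutator_def center_def)

lemma lie_p_Suc: "1 \<le> n \<Longrightarrow> lie_p (Suc n) x = commutator (lie_p n x) (x (Suc n))"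
  by (cases n) auto

lemma lie_p_cong: "(\<And>i. \<lbrakk>1 \<le> i; i \<le> n\<rbrakk> \<Longrightarrow> x i = y i) \<Longrightarrow> lie_p n x = lie_p n y"
proof (induction n)
  case (Suc n)
  then show ?case by (cases n) auto
qed simp

lemma lie_p_diff:
  assumes "1 \<le> i" "i \<le> n"
  shows "lie_p n (x(i := a - b)) = lie_p n (x(i := a)) - lie_p n (x(i := b))"
  using assms
proof (induction n)
  case (Suc n)
  show ?case
  proof (cases "n = 0")
    case False
    show ?thesis
    proof (cases "i = Suc n")
      case True
      have "lie_p n (x(i := c)) = lie_p n x" for c
        by (rule lie_p_cong) (use True in auto)
      then show ?thesis
        using True False by (simp add: lie_p_Suc del: fun_upd_apply) (simp add: commutator_diff_right)
    next
      case i: False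
      then show ?thesis
        using Suc False by (simp add: lie_p_Suc commutator_diff_left)
    qed
  qed (use Suc.prems in auto)
qed simp

lemma lie_p_center:
  assumes "2 \<le> n" "1 \<le> i" "i \<le> n" "x i \<in> center"
  shows "lie_p n x = 0"
  using assms
proof (induction n)
  case (Suc n)
  consider "i = Suc n" | "i \<le> n" "n = 1" | "i \<le> n" "2 \<le> n"
    using Suc.prems by linarith
  then show ?case
  proof cases
    case 2
    then have "i = 1" using Suc.prems by simp
    with 2 Suc.prems show ?thesis
      by (simp add: lie_p_Suc commutator_center)
  qed (use Suc in \<open>auto simp: lie_p_Suc commutator_center\<close>)
qed simp

primrec ad_right :: "'a::ring_1 \<Rightarrow> nat \<Rightarrow> 'a \<Rightarrow> 'a" where
  "ad_right y 0 u = u"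
| "ad_right y (Suc k) u = commutator (ad_right y k u) y"

lemma ad_right_shift: "ad_right y k (commutator u y) = ad_right y (Suc k) u"
  by (induction k) auto

lemma ad_right_add: "ad_right y k (u + v) = ad_right y k u + ad_right y k v"
  by (induction k) (auto simp: commutator_add_left)

text \<open>
  The eigenvalue is a sign so that its powers are central in the ring.
\<close>

lemma ad_right_eigen:
  assumes "commutator u y = s * u" "s = 1 \<or> s = -1"
  shows "ad_right y k u = s ^ k * u"
proof (induction k)
  case (Suc k)
  have "s ^ k = 1 \<or> s ^ k = -1"
    using assms(2) by (induction k) auto
  then have "commutator (s ^ k * u) y = s ^ k * commutator u y"
    by (auto simp: commutator_def)
  then show ?case
    by (simp add: Suc assms(1) power_commutes mult.assoc flip: mult.assoc)
qed simp

lemma lie_p_tail: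
  assumes "1 \<le> j" "\<And>i. \<lbrakk>j < i; i \<le> j + k\<rbrakk> \<Longrightarrow> x i = y"
  shows "lie_p (j + k) x = ad_right y k (lie_p j x)"
  using assms(2)
proof (induction k)
  case (Suc k)
  then show ?case using assms(1) by (simp add: lie_p_Suc)
qed simp

text \<open>
  Every long commutator used below has this shape: only the first argument and one further
  argument differ from the common value \<open>y\<close>.
\<close>

lemma lie_p_two_slots:
  assumes "i \<le> k"
  shows "lie_p (Suc (Suc k)) ((\<lambda>j. y)(1 := u, Suc (Suc i) := v))
    = ad_right y (k - i) (commutator (ad_right y i u) v)"
proof -
  let ?x = "(\<lambda>j. y)(1 := u, Suc (Suc i) := v)"
  have "lie_p (1 + i) ?x = ad_right y i (lie_p 1 ?x)"
    by (rule lie_p_tail) auto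
  then have "lie_p (Suc (Suc i)) ?x = commutator (ad_right y i u) v"
    by simp
  moreover have "lie_p (Suc (Suc i) + (k - i)) ?x = ad_right y (k - i) (lie_p (Suc (Suc i)) ?x)"
    by (rule lie_p_tail) auto
  ultimately show ?thesis using assms by simp
qed

section \<open>Derivations are Lie derivations\<close>

lemma derivation_commutator:
  assumes "\<And>x y. d (x - y) = d x - d (y :: 'a::ring_1)"
    and "\<And>x y. d (x * y) = d x * y + x * d y"
  shows "d (commutator x y) = commutator (d x) y + commutator x (d y)"
  by (simp add: commutator_def assms algebra_simps)

lemma derivation_lie_p:
  fixes d :: "'a::ring_1 \<Rightarrow> 'a"
  assumes d: "\<And>x y. d (x - y) = d x - d y"
      "\<And>x y. d (x * y) = d x * y + x * d y"
  shows "d (lie_p n x) = (\<Sum>i=1..n. lie_p n (x(i := d (x i))))"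
proof (induction n)
  case 0
  show ?case using d(1)[of 0 0] by simp
next
  case (Suc n)
  show ?case
  proof (cases "n = 0")
    case False
    have tail: "lie_p n (x(Suc n := c)) = lie_p n x" for c
      by (rule lie_p_cong) auto
    have "d (lie_p (Suc n) x)
        = commutator (d (lie_p n x)) (x (Suc n)) + commutator (lie_p n x) (d (x (Suc n)))"
      using False by (simp add: lie_p_Suc derivation_commutator d)
    also have "commutator (d (lie_p n x)) (x (Suc n))
        = (\<Sum>i=1..n. lie_p (Suc n) (x(i := d (x i))))"
      unfolding Suc.IH commutator_sum_left
      by (rule sum.cong) (use False in \<open>auto simp: lie_p_Suc\<close>)
    also have "commutator (lie_p n x) (d (x (Suc n))) = lie_p (Suc n) (x(Suc n := d (x (Suc n))))"
      using False by (simp add: lie_p_Suc tail del: fun_upd_apply) simp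
    finally show ?thesis by (simp del: fun_upd_apply)
  qed simp
qed

text \<open>
  Bracketing kills central elements, so \<open>\<phi>\<close> and \<open>\<phi> - \<tau>\<close> give the same right-hand side in
  the identity of a Lie \<open>n\<close>-derivation when \<open>\<tau>\<close> is central-valued.
\<close>

lemma lie_p_center_perturbation:
  assumes "2 \<le> n" "\<And>i. c i \<in> center"
  shows "(\<Sum>i=1..n. lie_p n (x(i := g i))) = (\<Sum>i=1..n. lie_p n (x(i := g i - c i)))"
proof (rule sum.cong)
  fix i assume i: "i \<in> {1..n}"
  have "lie_p n (x(i := c i)) = 0"
    by (rule lie_p_center[of _ i]) (use i assms in auto)
  then show "lie_p n (x(i := g i)) = lie_p n (x(i := g i - c i))"
    using lie_p_diff[of i n x "g i" "c i"] i by simp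
qed simp

lemma (in unital_algebra) inner_derivation: "derivation scale (\<lambda>x. commutator x w)"
  unfolding derivation_def module_hom_iff
  by (simp add: module_axioms commutator_def scale_mult_left scale_mult_right
      scale_right_diff_distrib algebra_simps)

section \<open>The Peirce decomposition\<close>

locale peirce_idempotent =
  fixes e f :: "'a::ring_1"
  assumes idem: "e * e = e" and f_eq: "f = 1 - e"
begin

lemma idem_f: "f * f = f" and ef: "e * f = 0" and fe: "f * e = 0" and e_plus_f: "e + f = 1"
  by (simp_all add: f_eq algebra_simps idem)

lemma idem_assoc: "e * (e * x) = e * x" "f * (f * x) = f * x" "e * (f * x) = 0" "f * (e * x) = 0"
  by (simp_all add: idem idem_f ef fe flip: mult.assoc)

lemmas idem_simps = idem idem_f ef fe idem_assoc

lemma peirceI [intro]: "u * x * v \<in> peirce u v"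
  by (auto simp: peirce_def)

lemma peirce_eeD:
  assumes "x \<in> peirce e e"
  shows "e * x = x" "x * e = x" "f * x = 0" "x * f = 0"
    "e * (x * y) = x * y" "x * (e * y) = x * y" "f * (x * y) = 0" "x * (f * y) = 0"
  using assms by (auto simp: peirce_def idem_simps mult.assoc)

lemma peirce_efD:
  assumes "x \<in> peirce e f"
  shows "e * x = x" "x * e = 0" "f * x = 0" "x * f = x"
    "e * (x * y) = x * y" "x * (e * y) = 0" "f * (x * y) = 0" "x * (f * y) = x * y"
  using assms by (auto simp: peirce_def idem_simps mult.assoc)

lemma peirce_feD:
  assumes "x \<in> peirce f e"
  shows "e * x = 0" "x * e = x" "f * x = x" "x * f = 0"
    "e * (x * y) = 0" "x * (e * y) = x * y" "f * (x * y) = x * y" "x * (f * y) = 0"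
  using assms by (auto simp: peirce_def idem_simps mult.assoc)

lemma peirce_ffD:
  assumes "x \<in> peirce f f"
  shows "e * x = 0" "x * e = 0" "f * x = x" "x * f = x"
    "e * (x * y) = 0" "x * (e * y) = 0" "f * (x * y) = x * y" "x * (f * y) = x * y"
  using assms by (auto simp: peirce_def idem_simps mult.assoc)

lemma peirce_memI: "\<lbrakk>u * x = x; x * v = x\<rbrakk> \<Longrightarrow> x \<in> peirce u v"
  unfolding peirce_def by (auto intro: exI[of _ x])

lemma peirce_mult: "x \<in> peirce u v \<Longrightarrow> y \<in> peirce v w \<Longrightarrow> x * y \<in> peirce u w"
  unfolding peirce_def by clarify (metis mult.assoc)

lemma peirce_mult_eq_0:
  assumes "x \<in> peirce u v" "y \<in> peirce u' v'" "v * u' = 0"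
  shows "x * y = 0"
proof -
  obtain x' y' where "x = u * x' * v" "y = u' * y' * v'"
    using assms by (auto simp: peirce_def)
  then have "x * y = u * x' * (v * u') * (y' * v')" by (simp only: mult.assoc)
  then show ?thesis using assms by simp
qed

lemma peirce_add: "x \<in> peirce u v \<Longrightarrow> y \<in> peirce u v \<Longrightarrow> x + y \<in> peirce u v"
  and peirce_diff: "x \<in> peirce u v \<Longrightarrow> y \<in> peirce u v \<Longrightarrow> x - y \<in> peirce u v"
  unfolding peirce_def by (auto simp flip: distrib_left distrib_right left_diff_distrib right_diff_distrib)

lemma decompose: "x = e * x * e + e * x * f + f * x * e + f * x * f"
proof -
  have "x = (e + f) * x * (e + f)" by (simp add: e_plus_f)
  then show ?thesis by (simp add: algebra_simps)
qed

lemma commutes_f_diag: "x * f = f * x \<Longrightarrow> x = e * x * e + f * x * f"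
  using decompose[of x] by (metis add.right_neutral ef fe mult.assoc mult_zero_left mult_zero_right)

lemma commutes_f_ee: "x * f = f * x \<Longrightarrow> f * x * f = 0 \<Longrightarrow> x \<in> peirce e e"
  and commutes_f_ff: "x * f = f * x \<Longrightarrow> e * x * e = 0 \<Longrightarrow> x \<in> peirce f f"
  using commutes_f_diag[of x] by (metis peirceI add_0 add.right_neutral)+

lemma commutator_f_ef: "m \<in> peirce e f \<Longrightarrow> commutator m f = m"
  and commutator_f_fe: "t \<in> peirce f e \<Longrightarrow> commutator t f = - t"
  by (simp_all add: commutator_def peirce_efD peirce_feD)

lemma ad_f_ef: "m \<in> peirce e f \<Longrightarrow> ad_right f k m = m"
  using ad_right_eigen[of m f 1 k] by (simp add: commutator_f_ef)

lemma ad_f_fe: "t \<in> peirce f e \<Longrightarrow> ad_right f k t = (-1) ^ k * t"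
  using ad_right_eigen[of t f "-1" k] by (simp add: commutator_f_fe)

text \<open>
  A single bracket with \<open>f\<close> already projects onto \<open>e A f + f A e\<close>; from then on it acts by
  the eigenvalues \<open>1\<close> and \<open>-1\<close>.
\<close>

lemma ad_f_Suc: "ad_right f (Suc k) u = e * u * f + (-1) ^ Suc k * (f * u * e)"
proof -
  have "commutator u f = e * u * f + - (f * u * e)"
    by (simp add: commutator_def f_eq algebra_simps)
  moreover have "- (f * u * e) \<in> peirce f e"
    by (rule peirce_memI) (simp_all add: idem_simps mult.assoc)
  moreover have "e * u * f \<in> peirce e f" by blast
  ultimately show ?thesis
    by (simp only: ad_right_shift[symmetric] ad_right_add ad_f_ef ad_f_fe) simp
qed

lemma neg_one_pow: "(-1::'a) ^ k = 1 \<or> (-1::'a) ^ k = -1"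
  by (induction k) auto

lemma sign_cancel: "(-1) ^ k * x = (-1) ^ k * y \<Longrightarrow> x = (y :: 'a)"
  using neg_one_pow[of k] by auto

end

locale faithful_peirce = peirce_idempotent +
  assumes faithful_e: "\<lbrakk>a \<in> peirce e e; \<And>m. m \<in> peirce e f \<Longrightarrow> a * m = 0;
      \<And>t. t \<in> peirce f e \<Longrightarrow> t * a = 0\<rbrakk> \<Longrightarrow> a = 0"
    and faithful_f: "\<lbrakk>b \<in> peirce f f; \<And>m. m \<in> peirce e f \<Longrightarrow> m * b = 0;
      \<And>t. t \<in> peirce f e \<Longrightarrow> b * t = 0\<rbrakk> \<Longrightarrow> b = 0"
begin

text \<open>
  If a central \<open>c\<close> lies in \<open>f A f\<close>, then \<open>m c = c m = 0\<close> for \<open>m\<close> in \<open>e A f\<close>, and likewise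
  \<open>c t = 0\<close> for \<open>t\<close> in \<open>f A e\<close>; faithfulness forces \<open>c = 0\<close>. Apply this to a difference of
  central elements.
\<close>

lemma center_eqI_e:
  assumes "z \<in> center" "z' \<in> center" "e * z * e = e * z' * e"
  shows "z = z'"
proof -
  define c where "c = z - z'"
  have c: "c * x = x * c" for x
    using assms(1,2) by (simp add: c_def center_def algebra_simps)
  have ece: "e * c * e = 0" using assms(3) by (simp add: c_def algebra_simps)
  have cff: "c \<in> peirce f f" by (rule commutes_f_ff) (fact c ece)+
  have "c = 0"
  proof (rule faithful_f[OF cff])
    show "m * c = 0" if "m \<in> peirce e f" for m
      using peirce_efD[OF that] peirce_ffD[OF cff] c by metis
    show "c * t = 0" if "t \<in> peirce f e" for t
      using peirce_feD[OF that] peirce_ffD[OF cff] c by metis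
  qed
  then show ?thesis by (simp add: c_def)
qed

lemma center_eqI_f:
  assumes "z \<in> center" "z' \<in> center" "f * z * f = f * z' * f"
  shows "z = z'"
proof -
  define c where "c = z - z'"
  have c: "c * x = x * c" for x
    using assms(1,2) by (simp add: c_def center_def algebra_simps)
  have fcf: "f * c * f = 0" using assms(3) by (simp add: c_def algebra_simps)
  have cee: "c \<in> peirce e e" by (rule commutes_f_ee) (fact c fcf)+
  have "c = 0"
  proof (rule faithful_e[OF cee])
    show "c * m = 0" if "m \<in> peirce e f" for m
      using peirce_efD[OF that] peirce_eeD[OF cee] c by metis
    show "t * c = 0" if "t \<in> peirce f e" for t
      using peirce_feD[OF that] peirce_eeD[OF cee] c by metis
  qed
  then show ?thesis by (simp add: c_def)
qed

text \<open>
  For \<open>a\<close> in \<open>e A e\<close> the bracket \<open>[a, y]\<close> lies in \<open>e A e\<close> and annihilates \<open>e A f\<close> on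
  one side, since both \<open>m\<close> and \<open>a m\<close> commute with \<open>y\<close>, and \<open>f A e\<close> on the other. So
  commuting with the off-diagonal components forces commuting with the diagonal ones.
\<close>

lemma center_criterion:
  assumes f: "y * f = f * y"
    and m: "\<And>m. m \<in> peirce e f \<Longrightarrow> m * y = y * m"
    and t: "\<And>t. t \<in> peirce f e \<Longrightarrow> t * y = y * t"
  shows "y \<in> center"
proof -
  have e: "y * e = e * y" using f by (simp add: f_eq algebra_simps)
  have a: "a * y = y * a" if A: "a \<in> peirce e e" for a
  proof -
    have "a * y - y * a = 0"
    proof (rule faithful_e)
      have "e * (y * a) = y * a" "a * (y * e) = a * y"
        using e peirce_eeD(1,2)[OF A] by (metis mult.assoc)+
      then show "a * y - y * a \<in> peirce e e"
        by (intro peirce_memI) (simp_all add: algebra_simps peirce_eeD[OF A])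
      fix m assume M: "m \<in> peirce e f"
      have "a * m \<in> peirce e f"
        by (rule peirce_memI) (simp_all add: mult.assoc peirce_eeD[OF A] peirce_efD[OF M])
      then have "a * m * y = y * (a * m)" by (rule m)
      then show "(a * y - y * a) * m = 0"
        using m[OF M] by (simp add: algebra_simps)
    next
      fix t assume T: "t \<in> peirce f e"
      have "t * a \<in> peirce f e"
        by (rule peirce_memI) (simp_all add: mult.assoc peirce_eeD[OF A] peirce_feD[OF T])
      then have "t * a * y = y * (t * a)" by (rule t)
      then show "t * (a * y - y * a) = 0"
        using t[OF T] by (simp add: right_diff_distrib flip: mult.assoc)
    qed
    then show ?thesis by simp
  qed
  have b: "b * y = y * b" if B: "b \<in> peirce f f" for b
  proof -
    have "b * y - y * b = 0"
    proof (rule faithful_f)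
      have "f * (y * b) = y * b" "b * (y * f) = b * y"
        using f peirce_ffD(3,4)[OF B] by (metis mult.assoc)+
      then show "b * y - y * b \<in> peirce f f"
        by (intro peirce_memI) (simp_all add: algebra_simps peirce_ffD[OF B])
      fix m assume M: "m \<in> peirce e f"
      have "m * b \<in> peirce e f"
        by (rule peirce_memI) (simp_all add: mult.assoc peirce_ffD[OF B] peirce_efD[OF M])
      then have "m * b * y = y * (m * b)" by (rule m)
      then show "m * (b * y - y * b) = 0"
        using m[OF M] by (simp add: right_diff_distrib flip: mult.assoc)
    next
      fix t assume T: "t \<in> peirce f e"
      have "b * t \<in> peirce f e"
        by (rule peirce_memI) (simp_all add: mult.assoc peirce_ffD[OF B] peirce_feD[OF T])
      then have "b * t * y = y * (b * t)" by (rule t)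
      then show "(b * y - y * b) * t = 0"
        using t[OF T] by (simp add: algebra_simps)
    qed
    then show ?thesis by simp
  qed
  have "y * x = x * y" for x
    by (subst (1 2) decompose[of x])
      (simp only: distrib_left distrib_right a[OF peirceI] m[OF peirceI] t[OF peirceI] b[OF peirceI])
  then show ?thesis by (simp add: center_def)
qed

end

section \<open>The value at the idempotent\<close>

lemma corner_of_nat: "u * (of_nat j * x) * v = of_nat j * (u * x * v)"
  for u :: "'a::ring_1"
  by (simp add: mult_of_nat_commute mult.assoc[of _ "of_nat j"] flip: mult.assoc)

lemma sum_from_one_split: "(\<Sum>i=1..Suc (Suc k). g i) = g 1 + (\<Sum>i\<le>k. g (Suc (Suc i)))"
  for g :: "nat \<Rightarrow> 'a::comm_monoid_add"
  by (induction k) (simp_all add: add.assoc)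

text \<open>
  The number of arguments is \<open>Suc (Suc k)\<close>, which makes the torsion coefficient
  \<open>Suc k\<close> and avoids subtraction. Scalars do not enter until linearity of the central part
  is needed.
\<close>

locale lie_peirce = faithful_peirce e f
  for e f :: "'a::ring_1" +
  fixes \<phi> :: "'a \<Rightarrow> 'a" and k :: nat
  assumes phi_add: "\<phi> (x + y) = \<phi> x + \<phi> y"
    and phi_lie_p: "\<phi> (lie_p (Suc (Suc k)) xs)
      = (\<Sum>i=1..Suc (Suc k). lie_p (Suc (Suc k)) (xs(i := \<phi> (xs i))))"
begin

lemma phi_0: "\<phi> 0 = 0"
  using phi_add[of 0 0] by simp

lemma phi_minus: "\<phi> (- x) = - \<phi> x"
  using phi_add[of x "- x"] by (simp add: phi_0 eq_neg_iff_add_eq_0 add.commute)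

lemma phi_diff: "\<phi> (x - y) = \<phi> x - \<phi> y"
  using phi_add[of x "- y"] by (simp add: phi_minus)

lemma phi_sign: "\<phi> ((-1) ^ j * x) = (-1) ^ j * \<phi> x"
  using neg_one_pow[of j] by (auto simp: phi_minus)

text \<open>
  Evaluate \<open>\<phi>\<close> at the commutator of \<open>u\<close> with \<open>Suc k\<close> copies of \<open>f\<close>. By the Jacobi
  identity \<open>[u, \<phi> f]\<close> is again an eigenvector for \<open>s\<close>, so it does not matter which copy
  of \<open>f\<close> is replaced by \<open>\<phi> f\<close>: each of them contributes the same summand.
\<close>

lemma phi_eigen:
  assumes u: "commutator u f = s * u" and s: "s = 1 \<or> s = -1"
    and y: "\<phi> f * f = f * \<phi> f"
  shows "\<phi> (s ^ Suc k * u)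
    = ad_right f (Suc k) (\<phi> u) + of_nat (Suc k) * (s ^ k * commutator u (\<phi> f))"
proof -
  let ?x = "(\<lambda>j. f)(1 := u)" and ?c = "commutator u (\<phi> f)"
  have sp: "s ^ j = 1 \<or> s ^ j = -1" for j
    using s by (induction j) auto
  have "commutator ?c f = commutator (commutator u f) (\<phi> f)"
    using y by (simp add: commutator_def algebra_simps) (simp add: y flip: mult.assoc)
  also have "\<dots> = s * ?c"
    using s u by (auto simp: commutator_def)
  finally have "commutator ?c f = s * ?c" .
  moreover have "commutator (s ^ j * ?c) f = s ^ j * commutator ?c f" for j
    using sp[of j] by (auto simp: commutator_def algebra_simps)
  ultimately have c: "commutator (s ^ j * ?c) f = s * (s ^ j * ?c)" for j
    by (simp add: power_commutes flip: mult.assoc)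
  have later: "lie_p (Suc (Suc k)) (?x(Suc (Suc i) := \<phi> f)) = s ^ k * ?c" if "i \<le> k" for i
  proof -
    have "commutator (ad_right f i u) (\<phi> f) = s ^ i * ?c"
      using sp[of i] by (auto simp: ad_right_eigen[OF u s] commutator_def)
    then have "lie_p (Suc (Suc k)) (?x(Suc (Suc i) := \<phi> f)) = ad_right f (k - i) (s ^ i * ?c)"
      by (simp only: lie_p_two_slots[OF that])
    also have "\<dots> = s ^ (k - i + i) * ?c"
      by (simp only: ad_right_eigen[OF c s] power_add mult.assoc)
    finally show ?thesis using that by simp
  qed
  have first: "lie_p (Suc (Suc k)) ((\<lambda>j. f)(1 := v)) = ad_right f (Suc k) v" for v
    using lie_p_tail[of 1 "Suc k" "(\<lambda>j. f)(1 := v)" f] by simp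
  have "\<phi> (lie_p (Suc (Suc k)) ?x)
      = lie_p (Suc (Suc k)) ((\<lambda>j. f)(1 := \<phi> u)) + (\<Sum>i\<le>k. s ^ k * ?c)"
    unfolding phi_lie_p sum_from_one_split
    using later by (intro arg_cong2[where f = "(+)"] sum.cong) simp_all
  then show ?thesis
    by (simp only: first ad_right_eigen[OF u s]) simp
qed

text \<open>
  In the formula for \<open>\<phi>\<close> at an eigenvector \<open>u\<close>, compare the components in the Peirce corner
  of \<open>u\<close>: the terms with \<open>\<phi> u\<close> cancel and only a multiple of \<open>[u, \<phi> f]\<close> remains.
\<close>

lemma phi_f_center:
  assumes torsion: "\<And>x::'a. of_nat (Suc k) * x = 0 \<Longrightarrow> x = 0"
    and y: "\<phi> f * f = f * \<phi> f"
  shows "\<phi> f \<in> center"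
proof (rule center_criterion)
  show "\<phi> f * f = f * \<phi> f" by (fact y)
  have y': "e * \<phi> f = \<phi> f * e" using y by (simp add: f_eq algebra_simps)
  fix m assume M: "m \<in> peirce e f"
  let ?c = "commutator m (\<phi> f)"
  have "e * (\<phi> f * m) = \<phi> f * m" "m * (\<phi> f * f) = m * \<phi> f"
    using y y' peirce_efD(1,4)[OF M] by (metis mult.assoc)+
  then have C: "?c \<in> peirce e f"
    by (intro peirce_memI) (simp_all add: commutator_def algebra_simps peirce_efD[OF M])
  have "\<phi> m = e * \<phi> m * f + (-1) ^ Suc k * (f * \<phi> m * e) + of_nat (Suc k) * ?c"
    using phi_eigen[of m 1] y by (simp only: commutator_f_ef[OF M] ad_f_Suc) simp
  then have "e * \<phi> m * f = e * (e * \<phi> m * f + (-1) ^ Suc k * (f * \<phi> m * e)) * f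
      + e * (of_nat (Suc k) * ?c) * f"
    by (metis distrib_left distrib_right)
  moreover have "e * (of_nat (Suc k) * ?c) * f = of_nat (Suc k) * ?c"
    unfolding corner_of_nat peirce_efD(1)[OF C] peirce_efD(4)[OF C] ..
  moreover have "e * (e * \<phi> m * f + (-1) ^ Suc k * (f * \<phi> m * e)) * f = e * \<phi> m * f"
    using neg_one_pow[of k] by (auto simp: algebra_simps idem_simps)
  ultimately have "of_nat (Suc k) * ?c = 0" by (metis add_left_cancel add.right_neutral)
  then have "?c = 0" by (rule torsion)
  then show "m * \<phi> f = \<phi> f * m" by (simp add: commutator_def)
next
  have y': "e * \<phi> f = \<phi> f * e" using y by (simp add: f_eq algebra_simps)
  fix t assume T: "t \<in> peirce f e"
  let ?c = "(-1) ^ k * commutator t (\<phi> f)"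
  have "f * (\<phi> f * t) = \<phi> f * t" "t * (\<phi> f * e) = t * \<phi> f"
    using y y' peirce_feD(2,3)[OF T] by (metis mult.assoc)+
  then have "commutator t (\<phi> f) \<in> peirce f e"
    by (intro peirce_memI) (simp_all add: commutator_def algebra_simps peirce_feD[OF T])
  then have C: "?c \<in> peirce f e"
    using neg_one_pow[of k] by (auto intro!: peirce_memI dest: peirce_feD)
  have "(-1) ^ Suc k * \<phi> t
      = e * \<phi> t * f + (-1) ^ Suc k * (f * \<phi> t * e) + of_nat (Suc k) * ?c"
    using phi_eigen[of t "-1"] y
    by (simp only: commutator_f_fe[OF T] ad_f_Suc phi_sign) simp
  then have "f * ((-1) ^ Suc k * \<phi> t) * e
      = f * (e * \<phi> t * f + (-1) ^ Suc k * (f * \<phi> t * e)) * e + f * (of_nat (Suc k) * ?c) * e"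
    by (metis distrib_left distrib_right)
  moreover have "f * (of_nat (Suc k) * ?c) * e = of_nat (Suc k) * ?c"
    unfolding corner_of_nat peirce_feD(3)[OF C] peirce_feD(2)[OF C] ..
  moreover have "f * (e * \<phi> t * f + (-1) ^ Suc k * (f * \<phi> t * e)) * e
      = f * ((-1) ^ Suc k * \<phi> t) * e"
    using neg_one_pow[of k] by (auto simp: algebra_simps idem_simps)
  ultimately have "of_nat (Suc k) * ?c = 0" by (metis add_left_cancel add.right_neutral)
  then have "?c = 0" by (rule torsion)
  then have "commutator t (\<phi> f) = 0" using neg_one_pow[of k] by auto
  then show "t * \<phi> f = \<phi> f * t" by (simp add: commutator_def)
qed

end

section \<open>Splitting off the central part\<close>

text \<open>
  The situation after the inner derivation has been subtracted: \<open>\<phi> f\<close> is central, and the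
  remaining assumptions are conditions (i), (ii) and (iii).
\<close>

locale normalized_lie_peirce = unital_algebra scale + lie_peirce e f \<phi> k
  for scale :: "'r::comm_ring_1 \<Rightarrow> 'a::ring_1 \<Rightarrow> 'a" and e f :: 'a and \<phi> :: "'a \<Rightarrow> 'a" and k :: nat +
  assumes phi_scale: "\<phi> (scale r x) = scale r (\<phi> x)"
    and phi_f: "\<phi> f \<in> center"
    and corner_e: "a \<in> peirce e e \<Longrightarrow> \<exists>z \<in> center. f * \<phi> a * f = f * z * f"
    and corner_f: "b \<in> peirce f f \<Longrightarrow> \<exists>z \<in> center. e * \<phi> b * e = e * z * e"
    and trace: "m \<in> peirce e f \<Longrightarrow> t \<in> peirce f e \<Longrightarrow>
      e * \<phi> (t * m) * e + f * \<phi> (m * t) * f \<in> center"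
    and off_e: "m \<in> peirce e f \<Longrightarrow> f * \<phi> m * e = 0"
    and off_f: "t \<in> peirce f e \<Longrightarrow> e * \<phi> t * f = 0"
begin

text \<open>
  The arguments equal to \<open>f\<close> contribute nothing because \<open>\<phi> f\<close> is central.
\<close>

lemma phi_two_slots:
  assumes "i \<le> k"
  shows "\<phi> (ad_right f (k - i) (commutator (ad_right f i u) v))
    = ad_right f (k - i) (commutator (ad_right f i (\<phi> u)) v)
    + ad_right f (k - i) (commutator (ad_right f i u) (\<phi> v))"
proof -
  let ?n = "Suc (Suc k)" and ?x = "(\<lambda>j. f)(1 := u, Suc (Suc i) := v)"
  have "\<phi> (lie_p ?n ?x) = (\<Sum>j=1..?n. lie_p ?n (?x(j := \<phi> (?x j))))"
    by (rule phi_lie_p)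
  also have "\<dots> = (\<Sum>j\<in>{1, Suc (Suc i)}. lie_p ?n (?x(j := \<phi> (?x j))))"
  proof (rule sum.mono_neutral_right)
    show "\<forall>j\<in>{1..?n} - {1, Suc (Suc i)}. lie_p ?n (?x(j := \<phi> (?x j))) = 0"
    proof
      fix j assume j: "j \<in> {1..?n} - {1, Suc (Suc i)}"
      show "lie_p ?n (?x(j := \<phi> (?x j))) = 0"
        by (rule lie_p_center[of _ j]) (use j phi_f in auto)
    qed
  qed (use assms in auto)
  also have "\<dots> = lie_p ?n (?x(1 := \<phi> u)) + lie_p ?n (?x(Suc (Suc i) := \<phi> v))"
    by simp
  also have "?x(1 := \<phi> u) = (\<lambda>j. f)(1 := \<phi> u, Suc (Suc i) := v)" by auto
  also have "?x(Suc (Suc i) := \<phi> v) = (\<lambda>j. f)(1 := u, Suc (Suc i) := \<phi> v)" by auto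
  finally show ?thesis by (simp only: lie_p_two_slots[OF assms])
qed

lemmas phi_first_two = phi_two_slots[of 0, simplified]
lemmas phi_first_last = phi_two_slots[of k, simplified]

lemma phi_ad_Suc: "\<phi> (ad_right f (Suc k) u) = e * \<phi> u * f + (-1) ^ Suc k * (f * \<phi> u * e)"
proof -
  have "ad_right f k 0 = 0" using ad_right_add[of f k 0 0] by simp
  then show ?thesis
    using phi_first_two[of u f] commutator_center(1)[OF phi_f, of u]
    by (simp only: ad_right_shift ad_f_Suc) simp
qed

lemma phi_ef: assumes M: "m \<in> peirce e f" shows "\<phi> m \<in> peirce e f"
proof -
  have "\<phi> m = e * \<phi> m * f"
    using phi_ad_Suc[of m] by (simp only: ad_f_ef[OF M] off_e[OF M]) simp
  then show ?thesis by (metis peirceI)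
qed

lemma phi_fe: assumes T: "t \<in> peirce f e" shows "\<phi> t \<in> peirce f e"
proof -
  have "(-1) ^ Suc k * \<phi> t = (-1) ^ Suc k * (f * \<phi> t * e)"
    using phi_ad_Suc[of t] by (simp only: ad_f_fe[OF T] off_f[OF T] phi_sign) simp
  then have "\<phi> t = f * \<phi> t * e" by (rule sign_cancel)
  then show ?thesis by (metis peirceI)
qed

lemma phi_diag:
  assumes x: "x * f = f * x"
  shows "\<phi> x * f = f * \<phi> x"
proof -
  have "e * x * f = 0" "f * x * e = 0"
    using x by (metis mult.assoc ef fe mult_zero_left mult_zero_right)+
  then have sum: "e * \<phi> x * f + (-1) ^ Suc k * (f * \<phi> x * e) = 0"
    using phi_ad_Suc[of x] by (simp only: ad_f_Suc phi_0) (simp add: phi_0)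
  have "e * (e * \<phi> x * f + (-1) ^ Suc k * (f * \<phi> x * e)) = e * \<phi> x * f"
    using neg_one_pow[of k] by (auto simp: algebra_simps idem_simps)
  with sum have 1: "e * \<phi> x * f = 0" by simp
  with sum have 2: "f * \<phi> x * e = 0" using neg_one_pow[of k] by auto
  have "\<phi> x * f = (e + f) * \<phi> x * f" by (simp add: e_plus_f)
  also have "\<dots> = f * \<phi> x * (e + f)" using 1 2 by (simp add: algebra_simps)
  finally show ?thesis by (simp add: e_plus_f)
qed

text \<open>
  The central part is built separately from the two diagonal components of the argument. The
  choice is unique, which yields linearity.
\<close>

definition \<tau>_e :: "'a \<Rightarrow> 'a"
  where "\<tau>_e x = (SOME z. z \<in> center \<and> f * z * f = f * \<phi> (e * x * e) * f)"

definition \<tau>_f :: "'a \<Rightarrow> 'a"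
  where "\<tau>_f x = (SOME z. z \<in> center \<and> e * z * e = e * \<phi> (f * x * f) * e)"

definition \<tau> :: "'a \<Rightarrow> 'a" where "\<tau> x = \<tau>_e x + \<tau>_f x"

definition h :: "'a \<Rightarrow> 'a" where "h x = \<phi> x - \<tau> x"

lemma tau_e: "\<tau>_e x \<in> center" "f * \<tau>_e x * f = f * \<phi> (e * x * e) * f"
proof -
  have "\<exists>z. z \<in> center \<and> f * z * f = f * \<phi> (e * x * e) * f"
    using corner_e[OF peirceI] by metis
  from someI_ex[OF this] show "\<tau>_e x \<in> center" "f * \<tau>_e x * f = f * \<phi> (e * x * e) * f"
    unfolding \<tau>_e_def by blast+
qed

lemma tau_f: "\<tau>_f x \<in> center" "e * \<tau>_f x * e = e * \<phi> (f * x * f) * e"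
proof -
  have "\<exists>z. z \<in> center \<and> e * z * e = e * \<phi> (f * x * f) * e"
    using corner_f[OF peirceI] by metis
  from someI_ex[OF this] show "\<tau>_f x \<in> center" "e * \<tau>_f x * e = e * \<phi> (f * x * f) * e"
    unfolding \<tau>_f_def by blast+
qed

lemma center_add: "x \<in> center \<Longrightarrow> y \<in> center \<Longrightarrow> x + y \<in> center"
  by (simp add: center_def algebra_simps)

lemma center_scale: "x \<in> center \<Longrightarrow> scale r x \<in> center"
  by (simp add: center_def scale_mult_left scale_mult_right)

lemma center_zero: "0 \<in> center"
  by (simp add: center_def)

lemma tau_center: "\<tau> x \<in> center"
  by (simp add: \<tau>_def center_add tau_e tau_f)

lemma tau_add: "\<tau> (x + y) = \<tau> x + \<tau> y"
proof -
  have "\<tau>_e (x + y) = \<tau>_e x + \<tau>_e y"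
    by (rule center_eqI_f) (auto intro: center_add tau_e(1), simp add: tau_e distrib_left distrib_right phi_add)
  moreover have "\<tau>_f (x + y) = \<tau>_f x + \<tau>_f y"
    by (rule center_eqI_e) (auto intro: center_add tau_f(1), simp add: tau_f distrib_left distrib_right phi_add)
  ultimately show ?thesis by (simp add: \<tau>_def)
qed

lemma tau_scale: "\<tau> (scale r x) = scale r (\<tau> x)"
proof -
  have "\<tau>_e (scale r x) = scale r (\<tau>_e x)"
    by (rule center_eqI_f)
      (auto intro: center_scale tau_e(1), simp add: tau_e scale_mult_left scale_mult_right phi_scale)
  moreover have "\<tau>_f (scale r x) = scale r (\<tau>_f x)"
    by (rule center_eqI_e)
      (auto intro: center_scale tau_f(1), simp add: tau_f scale_mult_left scale_mult_right phi_scale)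
  ultimately show ?thesis by (simp add: \<tau>_def scale_right_distrib)
qed

lemma tau_diff: "\<tau> (x - y) = \<tau> x - \<tau> y"
  using tau_add[of "x - y" y] by simp

lemma tau_e_eq_0: "e * x * e = 0 \<Longrightarrow> \<tau>_e x = 0"
  by (rule center_eqI_f) (auto simp: tau_e center_zero phi_0)

lemma tau_f_eq_0: "f * x * f = 0 \<Longrightarrow> \<tau>_f x = 0"
  by (rule center_eqI_e) (auto simp: tau_f center_zero phi_0)

lemma tau_ef: "m \<in> peirce e f \<Longrightarrow> \<tau> m = 0"
  and tau_fe: "t \<in> peirce f e \<Longrightarrow> \<tau> t = 0"
  by (simp_all add: \<tau>_def tau_e_eq_0 tau_f_eq_0 peirce_efD peirce_feD)

lemma tau_ee: "a \<in> peirce e e \<Longrightarrow> f * \<tau> a * f = f * \<phi> a * f"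
  and tau_ff: "b \<in> peirce f f \<Longrightarrow> e * \<tau> b * e = e * \<phi> b * e"
  by (simp_all add: \<tau>_def tau_e_eq_0 tau_f_eq_0 peirce_eeD peirce_ffD tau_e tau_f)

lemma h_ef: "m \<in> peirce e f \<Longrightarrow> h m = \<phi> m"
  and h_fe: "t \<in> peirce f e \<Longrightarrow> h t = \<phi> t"
  by (simp_all add: h_def tau_ef tau_fe)

lemma h_mem_ee: assumes A: "a \<in> peirce e e" shows "h a \<in> peirce e e"
proof (rule commutes_f_ee)
  have "\<phi> a * f = f * \<phi> a" by (rule phi_diag) (simp add: peirce_eeD[OF A])
  moreover have "\<tau> a * f = f * \<tau> a" using tau_center by (simp add: center_def)
  ultimately show "h a * f = f * h a" by (simp add: h_def algebra_simps)
  show "f * h a * f = 0" using tau_ee[OF A] by (simp add: h_def algebra_simps)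
qed

lemma h_mem_ff: assumes B: "b \<in> peirce f f" shows "h b \<in> peirce f f"
proof (rule commutes_f_ff)
  have "\<phi> b * f = f * \<phi> b" by (rule phi_diag) (simp add: peirce_ffD[OF B])
  moreover have "\<tau> b * f = f * \<tau> b" using tau_center by (simp add: center_def)
  ultimately show "h b * f = f * h b" by (simp add: h_def algebra_simps)
  show "e * h b * e = 0" using tau_ff[OF B] by (simp add: h_def algebra_simps)
qed

lemma h_mem:
  assumes "u \<in> {e, f}" "v \<in> {e, f}" "x \<in> peirce u v"
  shows "h x \<in> peirce u v"
  using assms h_mem_ee h_mem_ff phi_ef phi_fe by (auto simp: h_ef h_fe)

lemma h_add: "h (x + y) = h x + h y"
  by (simp add: h_def phi_add tau_add)

lemma h_diff: "h (x - y) = h x - h y"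
  by (simp add: h_def phi_diff tau_diff)

lemma commutator_h: "commutator (\<phi> u) v = commutator (h u) v" "commutator u (\<phi> v) = commutator u (h v)"
  by (simp_all add: h_def commutator_diff_left commutator_diff_right commutator_center tau_center)

text \<open>
  On off-diagonal brackets, appending arguments \<open>f\<close> changes at most the sign, so the short
  Leibniz rule follows from the long one.
\<close>

lemma h_commutator_ef:
  assumes "commutator u v \<in> peirce e f" "commutator (h u) v \<in> peirce e f"
    "commutator u (h v) \<in> peirce e f"
  shows "h (commutator u v) = commutator (h u) v + commutator u (h v)"
  using phi_first_two[of u v] by (simp add: commutator_h h_ef ad_f_ef assms)

lemma h_commutator_fe:
  assumes "commutator u v \<in> peirce f e" "commutator (h u) v \<in> peirce f e"
    "commutator u (h v) \<in> peirce f e"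
  shows "h (commutator u v) = commutator (h u) v + commutator u (h v)"
proof -
  have "(-1) ^ k * h (commutator u v) = (-1) ^ k * (commutator (h u) v + commutator u (h v))"
    using phi_first_two[of u v]
    by (simp add: commutator_h h_fe ad_f_fe assms phi_sign distrib_left)
  then show ?thesis by (rule sign_cancel)
qed

lemma h_ee_ef:
  assumes A: "a \<in> peirce e e" and M: "m \<in> peirce e f"
  shows "h (a * m) = h a * m + a * h m"
proof -
  have c: "commutator x y = x * y" "x * y \<in> peirce e f" if "x \<in> peirce e e" "y \<in> peirce e f" for x y
    using that by (auto simp: commutator_def ef fe peirce_mult peirce_mult_eq_0)
  show ?thesis
    using h_commutator_ef[of a m] by (simp add: c A M h_mem)
qed

lemma h_ef_ff:
  assumes M: "m \<in> peirce e f" and B: "b \<in> peirce f f"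
  shows "h (m * b) = h m * b + m * h b"
proof -
  have c: "commutator x y = x * y" "x * y \<in> peirce e f" if "x \<in> peirce e f" "y \<in> peirce f f" for x y
    using that by (auto simp: commutator_def ef fe peirce_mult peirce_mult_eq_0)
  show ?thesis
    using h_commutator_ef[of m b] by (simp add: c B M h_mem)
qed

lemma h_fe_ee:
  assumes T: "t \<in> peirce f e" and A: "a \<in> peirce e e"
  shows "h (t * a) = h t * a + t * h a"
proof -
  have c: "commutator x y = x * y" "x * y \<in> peirce f e" if "x \<in> peirce f e" "y \<in> peirce e e" for x y
    using that by (auto simp: commutator_def ef fe peirce_mult peirce_mult_eq_0)
  show ?thesis
    using h_commutator_fe[of t a] by (simp add: c A T h_mem)
qed

lemma h_ff_fe:
  assumes B: "b \<in> peirce f f" and T: "t \<in> peirce f e"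
  shows "h (b * t) = h b * t + b * h t"
proof -
  have c: "commutator x y = x * y" "x * y \<in> peirce f e" if "x \<in> peirce f f" "y \<in> peirce f e" for x y
    using that by (auto simp: commutator_def ef fe peirce_mult peirce_mult_eq_0)
  show ?thesis
    using h_commutator_fe[of b t] by (simp add: c B T h_mem)
qed

text \<open>
  Expanding \<open>h (a * a' * m)\<close> with the two ways of placing brackets shows that the defect of
  the Leibniz rule at \<open>(a, a')\<close> annihilates every \<open>m\<close> in \<open>e A f\<close>; symmetrically for
  \<open>t * a * a'\<close>.
\<close>

lemma h_ee_ee:
  assumes A: "a \<in> peirce e e" and A': "a' \<in> peirce e e"
  shows "h (a * a') = h a * a' + a * h a'"
proof -
  have "h (a * a') - (h a * a' + a * h a') = 0"
  proof (rule faithful_e)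
    show "h (a * a') - (h a * a' + a * h a') \<in> peirce e e"
      using A A' by (intro peirce_diff peirce_add h_mem peirce_mult[of _ _ e]) auto
    fix m assume M: "m \<in> peirce e f"
    have "a' * m \<in> peirce e f" "a * a' \<in> peirce e e"
      using A A' M by (auto intro: peirce_mult)
    then show "(h (a * a') - (h a * a' + a * h a')) * m = 0"
      using h_ee_ef[of "a * a'" m] h_ee_ef[of a "a' * m"] h_ee_ef[of a' m] A A' M
      by (simp add: algebra_simps)
  next
    fix t assume T: "t \<in> peirce f e"
    have "t * a \<in> peirce f e" "a * a' \<in> peirce e e"
      using A A' T by (auto intro: peirce_mult)
    then show "t * (h (a * a') - (h a * a' + a * h a')) = 0"
      using h_fe_ee[of t "a * a'"] h_fe_ee[of "t * a" a'] h_fe_ee[of t a] A A' T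
      by (simp add: algebra_simps)
  qed
  then show ?thesis by simp
qed

lemma h_ff_ff:
  assumes B: "b \<in> peirce f f" and B': "b' \<in> peirce f f"
  shows "h (b * b') = h b * b' + b * h b'"
proof -
  have "h (b * b') - (h b * b' + b * h b') = 0"
  proof (rule faithful_f)
    show "h (b * b') - (h b * b' + b * h b') \<in> peirce f f"
      using B B' by (intro peirce_diff peirce_add h_mem peirce_mult[of _ _ f]) auto
    fix m assume M: "m \<in> peirce e f"
    have "m * b \<in> peirce e f" "b * b' \<in> peirce f f"
      using B B' M by (auto intro: peirce_mult)
    then show "m * (h (b * b') - (h b * b' + b * h b')) = 0"
      using h_ef_ff[of m "b * b'"] h_ef_ff[of "m * b" b'] h_ef_ff[of m b] B B' M
      by (simp add: algebra_simps)
  next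
    fix t assume T: "t \<in> peirce f e"
    have "b' * t \<in> peirce f e" "b * b' \<in> peirce f f"
      using B B' T by (auto intro: peirce_mult)
    then show "(h (b * b') - (h b * b' + b * h b')) * t = 0"
      using h_ff_fe[of "b * b'" t] h_ff_fe[of b "b' * t"] h_ff_fe[of b' t] B B' T
      by (simp add: algebra_simps)
  qed
  then show ?thesis by simp
qed

text \<open>
  The element of condition (ii) has the diagonal components \<open>e * \<tau> (t * m) * e\<close> and
  \<open>f * \<tau> (m * t) * f\<close>. Being central, it equals each of the two central elements.
\<close>

lemma tau_trace:
  assumes M: "m \<in> peirce e f" and T: "t \<in> peirce f e"
  shows "\<tau> (m * t) = \<tau> (t * m)"
proof -
  let ?c = "e * \<phi> (t * m) * e + f * \<phi> (m * t) * f"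
  have mem: "m * t \<in> peirce e e" "t * m \<in> peirce f f"
    using M T by (auto intro: peirce_mult)
  have "?c = \<tau> (m * t)"
    by (rule center_eqI_f[OF trace[OF M T] tau_center])
      (use tau_ee[OF mem(1)] in \<open>simp add: distrib_left distrib_right mult.assoc idem_simps\<close>)
  moreover have "?c = \<tau> (t * m)"
    by (rule center_eqI_e[OF trace[OF M T] tau_center])
      (use tau_ff[OF mem(2)] in \<open>simp add: distrib_left distrib_right mult.assoc idem_simps\<close>)
  ultimately show ?thesis by simp
qed

text \<open>
  The rule for \<open>[m, t]\<close> equates the defects of the Leibniz rule at \<open>(m, t)\<close> and
  \<open>(t, m)\<close>. The first lies in \<open>e A e\<close> and the second in \<open>f A f\<close>, so both are zero.
\<close>

lemma h_ef_fe:
  assumes M: "m \<in> peirce e f" and T: "t \<in> peirce f e"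
  shows "h (m * t) = h m * t + m * h t" "h (t * m) = h t * m + t * h m"
proof -
  have hM: "h m \<in> peirce e f" and hT: "h t \<in> peirce f e"
    using M T by (auto intro: h_mem)
  have "\<phi> (commutator m t) = commutator (h m) t + commutator m (h t)"
    using phi_first_last[of m t] by (simp add: ad_f_ef M phi_ef) (simp add: commutator_h)
  moreover have "\<tau> (commutator m t) = 0"
    by (simp add: commutator_def tau_diff tau_trace[OF M T])
  ultimately have "h (commutator m t) = commutator (h m) t + commutator m (h t)"
    by (simp add: h_def)
  then have eq: "h (m * t) - (h m * t + m * h t) = h (t * m) - (h t * m + t * h m)" (is "?l = ?r")
    by (simp add: commutator_def h_diff algebra_simps)
  have "?l \<in> peirce e e"
    using M T hM hT by (intro peirce_diff peirce_add h_mem) (auto intro: peirce_mult)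
  moreover have "?r \<in> peirce f f"
    using M T hM hT by (intro peirce_diff peirce_add h_mem) (auto intro: peirce_mult)
  ultimately have "?l = 0" "?r = 0"
    using eq peirce_eeD(1) peirce_ffD(1) by metis+
  then show "h (m * t) = h m * t + m * h t" "h (t * m) = h t * m + t * h m" by simp_all
qed

lemma h_0: "h 0 = 0"
  using h_add[of 0 0] by simp

lemma h_mult_peirce:
  assumes "u \<in> {e, f}" "v \<in> {e, f}" "u' \<in> {e, f}" "v' \<in> {e, f}"
    and x: "x \<in> peirce u v" and y: "y \<in> peirce u' v'"
  shows "h (x * y) = h x * y + x * h y"
proof (cases "u' = v")
  case True
  then show ?thesis
    using assms h_ee_ee h_ee_ef h_ef_ff h_fe_ee h_ff_fe h_ff_ff h_ef_fe by auto
next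
  case False
  then have "v * u' = 0" using assms idem_simps by auto
  then show ?thesis
    using assms h_mem[OF assms(1,2) x] h_mem[OF assms(3,4) y]
    by (simp add: h_0 peirce_mult_eq_0[of _ u v _ u' v'])
qed

lemma h_mult: "h (x * y) = h x * y + x * h y"
proof -
  have 1: "h (x * y) = h x * y + x * h y"
    if "u \<in> {e, f}" "v \<in> {e, f}" "x \<in> peirce u v" for u v x y
  proof -
    have "h (x * (u' * y * v')) = h x * (u' * y * v') + x * h (u' * y * v')"
      if "u' \<in> {e, f}" "v' \<in> {e, f}" for u' v'
      using that \<open>u \<in> {e, f}\<close> \<open>v \<in> {e, f}\<close> \<open>x \<in> peirce u v\<close>
      by (intro h_mult_peirce[of u v u' v']) auto
    then have "h (x * (e * y * e + e * y * f + f * y * e + f * y * f))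
        = h x * (e * y * e + e * y * f + f * y * e + f * y * f)
        + x * h (e * y * e + e * y * f + f * y * e + f * y * f)"
      by (simp add: distrib_left h_add)
    then show ?thesis by (simp flip: decompose)
  qed
  have "h (u * x * v * y) = h (u * x * v) * y + u * x * v * h y"
    if "u \<in> {e, f}" "v \<in> {e, f}" for u v
    using that by (intro 1[of u v]) auto
  then have "h ((e * x * e + e * x * f + f * x * e + f * x * f) * y)
      = h (e * x * e + e * x * f + f * x * e + f * x * f) * y
      + (e * x * e + e * x * f + f * x * e + f * x * f) * h y"
    by (simp add: distrib_right h_add)
  then show ?thesis by (simp flip: decompose)
qed

lemma normalized_standard: "standard scale (Suc (Suc k)) \<phi>"
  unfolding standard_def
proof (intro exI conjI allI)
  show "derivation scale h"
    unfolding derivation_def module_hom_iff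
    by (auto simp: module_axioms h_add h_mult)
      (simp add: h_def phi_scale tau_scale scale_right_diff_distrib)
  show "module_hom scale scale \<tau>"
    unfolding module_hom_iff by (auto simp: module_axioms tau_add tau_scale)
  show "range \<tau> \<subseteq> center" using tau_center by auto
  show "\<phi> x = h x + \<tau> x" for x by (simp add: h_def)
  fix x
  let ?n = "Suc (Suc k)"
  have "\<phi> (lie_p ?n x) = (\<Sum>i=1..?n. lie_p ?n (x(i := \<phi> (x i) - \<tau> (x i))))"
    unfolding phi_lie_p by (rule lie_p_center_perturbation) (auto intro: tau_center)
  also have "\<dots> = h (lie_p ?n x)"
    by (simp only: derivation_lie_p[of h, OF h_diff h_mult] flip: h_def)
  finally show "\<tau> (lie_p ?n x) = 0" by (simp add: h_def)
qed

end

section \<open>The characterisation\<close>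

lemma (in unital_algebra) standard_add_derivation:
  assumes "standard scale n \<phi>" "derivation scale d"
  shows "standard scale n (\<lambda>x. \<phi> x + d x)"
proof -
  from assms(1) obtain h \<tau> where h: "derivation scale h" and \<tau>: "module_hom scale scale \<tau>"
    "range \<tau> \<subseteq> center" "\<forall>x. \<tau> (lie_p n x) = 0" "\<forall>x. \<phi> x = h x + \<tau> x"
    unfolding standard_def by blast
  have "module_pair scale scale" by unfold_locales
  then have "derivation scale (\<lambda>x. h x + d x)"
    using h assms(2) unfolding derivation_def
    by (auto intro: module_pair.module_hom_add simp: algebra_simps)
  then show ?thesis
    unfolding standard_def using \<tau>
    by (intro exI[of _ "\<lambda>x. h x + d x"] exI[of _ \<tau>]) (auto simp: algebra_simps)
qed

theorem corollary2p6:
  fixes scale :: "'r::comm_ring_1 \<Rightarrow> 'a::ring_1 \<Rightarrow> 'a"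
    and n :: nat and e f :: 'a and \<phi> :: "'a \<Rightarrow> 'a"
  assumes "n \<ge> 2"
    and "unital_algebra scale"
    and "e * e = e" and "e \<noteq> 0" and "e \<noteq> 1" and "f = 1 - e"
    and "\<And>x::'a. of_nat 2 * x = 0 \<Longrightarrow> x = 0"
    and "\<And>x::'a. of_nat (n - 1) * x = 0 \<Longrightarrow> x = 0"
    and "\<And>x. \<lbrakk>(\<lambda>m. (e * x * e) * m) ` peirce e f = {0};
               (\<lambda>t. t * (e * x * e)) ` peirce f e = {0}\<rbrakk> \<Longrightarrow> e * x * e = 0"
    and "\<And>x. \<lbrakk>(\<lambda>m. m * (f * x * f)) ` peirce e f = {0};
               (\<lambda>t. (f * x * f) * t) ` peirce f e = {0}\<rbrakk> \<Longrightarrow> f * x * f = 0"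
    and "lie_n_derivation scale n \<phi>"
  shows "standard scale n \<phi> \<longleftrightarrow>
    ((\<lambda>a. f * \<phi> a * f) ` peirce e e \<subseteq> (\<lambda>z. f * z * f) ` center \<and>
     (\<lambda>b. e * \<phi> b * e) ` peirce f f \<subseteq> (\<lambda>z. e * z * e) ` center) \<and>
    (\<forall>m \<in> peirce e f. \<forall>t \<in> peirce f e. e * \<phi> (t * m) * e + f * \<phi> (m * t) * f \<in> center) \<and>
    ((\<lambda>m. f * \<phi> m * e) ` peirce e f = {0} \<and>
     (\<lambda>t. e * \<phi> t * f) ` peirce f e = {0})"
    (is "_ \<longleftrightarrow> ?conditions")
proof -
  interpret unital_algebra scale by fact
  interpret peirce_idempotent e f by unfold_locales fact+
  have image_0: "g ` peirce u v = {0} \<longleftrightarrow> (\<forall>x \<in> peirce u v. g x = 0)" for g and u v :: 'a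
  proof -
    have "peirce u v \<noteq> {}" by (auto simp: peirce_def)
    then show ?thesis by auto
  qed
  interpret faithful_peirce e f
  proof
    fix a assume A: "a \<in> peirce e e" and "\<And>m. m \<in> peirce e f \<Longrightarrow> a * m = 0"
      "\<And>t. t \<in> peirce f e \<Longrightarrow> t * a = 0"
    moreover have "e * a * e = a" by (simp add: peirce_eeD[OF A])
    ultimately show "a = 0" using assms(9)[of a] unfolding image_0 by simp
  next
    fix b assume B: "b \<in> peirce f f" and "\<And>m. m \<in> peirce e f \<Longrightarrow> m * b = 0"
      "\<And>t. t \<in> peirce f e \<Longrightarrow> b * t = 0"
    moreover have "f * b * f = b" by (simp add: peirce_ffD[OF B])
    ultimately show "b = 0" using assms(10)[of b] unfolding image_0 by simp
  qed
  obtain k where n: "n = Suc (Suc k)"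
    using \<open>n \<ge> 2\<close> by (metis add_2_eq_Suc le_Suc_ex)
  have hom: "module_hom scale scale \<phi>"
    and lie: "\<phi> (lie_p n x) = (\<Sum>i=1..n. lie_p n (x(i := \<phi> (x i))))" for x
    using assms(11) by (auto simp: lie_n_derivation_def)
  show ?thesis
  proof
    assume "standard scale n \<phi>"
    then obtain h \<tau> where h: "derivation scale h" and hom_\<tau>: "module_hom scale scale \<tau>"
      and range_\<tau>: "range \<tau> \<subseteq> center" and \<tau>_lie: "\<And>x. \<tau> (lie_p n x) = 0"
      and \<phi>: "\<And>x. \<phi> x = h x + \<tau> x"
      unfolding standard_def by blast
    have \<tau>: "\<tau> x \<in> center" for x using range_\<tau> by auto
    have h_mult: "h (x * y) = h x * y + x * h y" for x y
      using h by (auto simp: derivation_def)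
    have \<tau>_swap: "\<tau> x * y = y * \<tau> x" for x y
      using \<tau>[of x] by (simp add: center_def)
    have h_corner: "v * h (u * x * u') * v' = 0" if "v * u = 0" "u' * v' = 0" for u u' v v' x
    proof -
      have "v * h (u * x * u') * v'
          = v * h u * x * (u' * v') + (v * u) * h x * u' * v' + (v * u) * x * h u' * v'"
        by (simp add: h_mult algebra_simps)
      then show ?thesis using that by simp
    qed
    have 1: "\<exists>z \<in> center. v * \<phi> a * v = v * z * v" if "a \<in> peirce u u" "v * u = 0" "u * v = 0" for a u v
    proof -
      have "v * h a * v = 0" using that h_corner by (auto simp: peirce_def)
      then show ?thesis using \<tau>[of a] by (auto simp: \<phi> algebra_simps)
    qed
    have 2: "v * \<phi> m * u = 0" if "m \<in> peirce u v" "v * u = 0" for m u v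
    proof -
      have "v * h m * u = 0" using that h_corner[of v u v u] by (auto simp: peirce_def)
      moreover have "v * \<tau> m * u = v * u * \<tau> m" by (simp add: \<tau>_swap mult.assoc)
      ultimately show ?thesis using that by (simp add: \<phi> algebra_simps)
    qed
    have 3: "e * \<phi> (t * m) * e + f * \<phi> (m * t) * f \<in> center"
      if M: "m \<in> peirce e f" and T: "t \<in> peirce f e" for m t
    proof -
      \<comment> \<open>Inserting arguments \<open>f\<close> after \<open>m\<close> does not change the commutator, since \<open>[m, f] = m\<close>.\<close>
      have "\<tau> (commutator m t) = 0"
        using \<tau>_lie[of "(\<lambda>j. f)(1 := m, Suc (Suc k) := t)"]
        by (simp only: n lie_p_two_slots[OF le_refl] ad_f_ef[OF M]) simp
      then have eq: "\<tau> (m * t) = \<tau> (t * m)"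
        by (simp add: commutator_def module_hom.diff[OF hom_\<tau>])
      have "m * t \<in> peirce e e" "t * m \<in> peirce f f"
        by (rule peirce_memI; simp add: peirce_efD[OF M] peirce_feD[OF T] mult.assoc)+
      then have "f * h (m * t) * f = 0" "e * h (t * m) * e = 0"
        using h_corner ef fe by (auto simp: peirce_def)
      then have "e * \<phi> (t * m) * e + f * \<phi> (m * t) * f = e * \<tau> (t * m) * e + f * \<tau> (t * m) * f"
        by (simp add: \<phi> eq algebra_simps)
      also have "\<dots> = (e + f) * \<tau> (t * m)"
        unfolding distrib_right by (simp add: \<tau>_swap mult.assoc idem idem_f)
          (simp add: idem_simps flip: mult.assoc)
      finally show ?thesis using \<tau> by (simp add: e_plus_f)
    qed
    show ?conditions
      unfolding image_0 using 1 2 3 ef fe by (auto simp: image_iff)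
  next
    assume cond: ?conditions
    \<comment> \<open>Then \<open>[f, w]\<close> is the off-diagonal part of \<open>\<phi> f\<close>, and \<open>\<psi> f\<close> is diagonal.\<close>
    define w where "w = f * \<phi> f * e - e * \<phi> f * f"
    define \<psi> where "\<psi> x = \<phi> x - commutator x w" for x
    have inner: "derivation scale (\<lambda>x. commutator x w)" by (rule inner_derivation)
    have \<psi>_lie: "\<psi> (lie_p n x) = (\<Sum>i=1..n. lie_p n (x(i := \<psi> (x i))))" for x
    proof -
      have "commutator (lie_p n x) w = (\<Sum>i=1..n. lie_p n (x(i := commutator (x i) w)))"
        by (rule derivation_lie_p) (simp_all add: commutator_def algebra_simps)
      then have "\<psi> (lie_p n x)
          = (\<Sum>i=1..n. lie_p n (x(i := \<phi> (x i))) - lie_p n (x(i := commutator (x i) w)))"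
        by (simp only: \<psi>_def lie sum_subtractf)
      also have "\<dots> = (\<Sum>i=1..n. lie_p n (x(i := \<psi> (x i))))"
        unfolding \<psi>_def by (rule sum.cong) (simp_all only: atLeastAtMost_iff lie_p_diff)
      finally show ?thesis .
    qed
    interpret lie_peirce e f \<psi> k
    proof
      show "\<psi> (x + y) = \<psi> x + \<psi> y" for x y
        by (simp add: \<psi>_def module_hom.add[OF hom] commutator_add_left)
      show "\<psi> (lie_p (Suc (Suc k)) x)
          = (\<Sum>i=1..Suc (Suc k). lie_p (Suc (Suc k)) (x(i := \<psi> (x i))))" for x
        using \<psi>_lie[of x] by (simp only: n)
    qed
    have "\<psi> f * f = f * \<psi> f"
    proof -
      have "\<psi> f = \<phi> f - f * \<phi> f * e - e * \<phi> f * f"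
        by (simp add: \<psi>_def w_def commutator_def algebra_simps idem_simps)
      also have "\<dots> = e * \<phi> f * e + f * \<phi> f * f"
        by (subst (1) decompose[of "\<phi> f"]) simp
      finally show ?thesis by (simp add: algebra_simps idem_simps)
    qed
    then have \<psi>_f: "\<psi> f \<in> center"
      using phi_f_center assms(8) n by simp
    \<comment> \<open>The inner derivation does not affect conditions (i) and (ii).\<close>
    have diag: "u * commutator x w * u = 0" if "x \<in> peirce v v" "u * v = 0" "v * u = 0" for u v x
    proof -
      from that(1) obtain x' where x: "x = v * x' * v" by (auto simp: peirce_def)
      have "u * commutator x w * u = (u * v) * x' * v * w * u - u * w * v * x' * (v * u)"
        by (simp add: x commutator_def algebra_simps)
      then show ?thesis using that by simp
    qed
    interpret normalized_lie_peirce scale e f \<psi> k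
    proof
      show "\<psi> (scale r x) = scale r (\<psi> x)" for r x
        by (simp add: \<psi>_def module_hom.scale[OF hom] commutator_def scale_mult_left
            scale_mult_right scale_right_diff_distrib)
      show "\<psi> f \<in> center" by (fact \<psi>_f)
      show "\<exists>z\<in>center. f * \<psi> a * f = f * z * f" if "a \<in> peirce e e" for a
        using cond diag[OF that] that ef fe
        by (auto simp: \<psi>_def left_diff_distrib right_diff_distrib)
      show "\<exists>z\<in>center. e * \<psi> b * e = e * z * e" if "b \<in> peirce f f" for b
        using cond diag[OF that] that ef fe
        by (auto simp: \<psi>_def left_diff_distrib right_diff_distrib)
      show "e * \<psi> (t * m) * e + f * \<psi> (m * t) * f \<in> center"
        if M: "m \<in> peirce e f" and T: "t \<in> peirce f e" for m t
      proof -
        have "m * t \<in> peirce e e" "t * m \<in> peirce f f"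
          by (rule peirce_memI; simp add: peirce_efD[OF M] peirce_feD[OF T] mult.assoc)+
        then have "f * commutator (m * t) w * f = 0" "e * commutator (t * m) w * e = 0"
          using diag ef fe by blast+
        then show ?thesis
          using cond M T by (simp add: \<psi>_def left_diff_distrib right_diff_distrib)
      qed
      show "f * \<psi> m * e = 0" if M: "m \<in> peirce e f" for m
      proof -
        have "f * commutator m w * e = 0"
          by (simp add: commutator_def w_def algebra_simps peirce_efD[OF M] idem_simps)
        then show ?thesis
          using cond M unfolding image_0 by (simp add: \<psi>_def left_diff_distrib right_diff_distrib)
      qed
      show "e * \<psi> t * f = 0" if T: "t \<in> peirce f e" for t
      proof -
        have "e * commutator t w * f = 0"
          by (simp add: commutator_def w_def algebra_simps peirce_feD[OF T] idem_simps)
        then show ?thesis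
          using cond T unfolding image_0 by (simp add: \<psi>_def left_diff_distrib right_diff_distrib)
      qed
    qed
    have "standard scale n (\<lambda>x. \<psi> x + commutator x w)"
      unfolding n by (rule standard_add_derivation[OF normalized_standard inner])
    then show "standard scale n \<phi>" by (simp add: \<psi>_def)
  qed
qed

end
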